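(* Let $\mu$ be a Radon measure on a real Banach space $E$ which has linear support, and let $F\subseteq E^*$ be such that its points are separated by $E_\mu$ (that is, for all distinct $x^*,y^*\in F$ there is $x\in E_\mu$ with $\langle x,x^*\rangle\ne\langle x,y^*\rangle$). Then the family $\{x\mapsto\exp(i\langle x,x^*\rangle):\ x^*\in F\}$ is linearly independent in $L^2(E,\mu)$.
   Context: A (finite) Radon measure $\mu$ on $E$ is a finite Borel measure such that for all $\varepsilon>0$ there is a compact $K\subseteq E$ with $\mu(E\setminus K)<\varepsilon$. The support $\mathrm{supp}(\mu)$ is the complement of the union of all open $\mu$-null sets in $E$, and $E_\mu$ is the closed linear span of $\mathrm{supp}(\mu)$. The measure $\mu$ has linear support if $\mathrm{supp}(\mu)=E_\mu$. Here $L^2(E,\mu)$ is the space of complex-valued square-integrable functions. *)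

theory Defs
  imports
    "HOL-Analysis.Analysis"
    "HOL-Algebra.Module"
begin

definition finite_radon_measure :: "'a::t2_space measure \<Rightarrow> bool" where
  "finite_radon_measure \<mu> \<longleftrightarrow>
     sets \<mu> = sets borel \<and> finite_measure \<mu> \<and>
     (\<forall>\<epsilon>>0. \<exists>K. compact K \<and> measure \<mu> (UNIV - K) < \<epsilon>)"

definition measure_support :: "'a::topological_space measure \<Rightarrow> 'a set" where
  "measure_support \<mu> = - \<Union>{U. open U \<and> emeasure \<mu> U = 0}"

definition closed_linear_span :: "'a::real_normed_vector set \<Rightarrow> 'a set" where
  "closed_linear_span S = closure (span S)"

definition linear_support :: "'a::real_normed_vector measure \<Rightarrow> bool" where
  "linear_support \<mu> \<longleftrightarrow> measure_support \<mu> = closed_linear_span (measure_support \<mu>)"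

definition complex_ring :: "complex ring" where
  "complex_ring = \<lparr>carrier = UNIV, monoid.mult = (*), one = 1, ring.zero = 0, add = (+)\<rparr>"

lemma complex_ring_field: "field complex_ring"
proof -
  have ab: "abelian_group complex_ring"
  proof (rule abelian_groupI)
    fix x assume "x \<in> carrier complex_ring"
    have "- x \<oplus>\<^bsub>complex_ring\<^esub> x = \<zero>\<^bsub>complex_ring\<^esub>" "- x \<in> carrier complex_ring"
      by (simp_all add: complex_ring_def)
    then show "\<exists>y\<in>carrier complex_ring. y \<oplus>\<^bsub>complex_ring\<^esub> x = \<zero>\<^bsub>complex_ring\<^esub>" ..
  qed (simp_all add: complex_ring_def)
  have cr: "cring complex_ring"
    by (rule cringI[OF ab]) (unfold_locales, simp_all add: complex_ring_def distrib_right)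
  show ?thesis
  proof (rule cring.cring_fieldI2[OF cr])
    show "\<zero>\<^bsub>complex_ring\<^esub> \<noteq> \<one>\<^bsub>complex_ring\<^esub>"
      by (simp add: complex_ring_def)
  next
    fix a assume "a \<in> carrier complex_ring" "a \<noteq> \<zero>\<^bsub>complex_ring\<^esub>"
    then have "a \<otimes>\<^bsub>complex_ring\<^esub> inverse a = \<one>\<^bsub>complex_ring\<^esub>" "inverse a \<in> carrier complex_ring"
      by (simp_all add: complex_ring_def)
    then show "\<exists>b\<in>carrier complex_ring. a \<otimes>\<^bsub>complex_ring\<^esub> b = \<one>\<^bsub>complex_ring\<^esub>" ..
  qed
qed

definition L2_fun :: "'a measure \<Rightarrow> ('a \<Rightarrow> complex) set" where
  "L2_fun \<mu> = {f \<in> borel_measurable \<mu>. integrable \<mu> (\<lambda>x. (cmod (f x))\<^sup>2)}"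

definition L2_class :: "'a measure \<Rightarrow> ('a \<Rightarrow> complex) \<Rightarrow> ('a \<Rightarrow> complex) set" where
  "L2_class \<mu> f = {g \<in> L2_fun \<mu>. AE x in \<mu>. g x = f x}"

text \<open>Addition and scalar multiplication are given without choosing representatives: the classes in
  each union all coincide. Only the vector space structure of the record is used; the ring
  multiplication and its unit are left unspecified. If no square-integrable function agrees with
  \<open>f\<close> almost everywhere, then \<open>L2_class \<mu> f\<close> is empty and hence not in the carrier.\<close>

definition L2 :: "'a measure \<Rightarrow> (complex, ('a \<Rightarrow> complex) set) module" where
  "L2 \<mu> = \<lparr>
     carrier = L2_class \<mu> ` L2_fun \<mu>,
     monoid.mult = undefined,
     one = undefined,
     ring.zero = L2_class \<mu> (\<lambda>x. 0),
     add = (\<lambda>A B. \<Union>f\<in>A. \<Union>g\<in>B. L2_class \<mu> (\<lambda>x. f x + g x)),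
     smult = (\<lambda>c A. \<Union>f\<in>A. L2_class \<mu> (\<lambda>x. c * f x)) \<rparr>"

lemma L2_fun_add:
  assumes "f \<in> L2_fun \<mu>" "g \<in> L2_fun \<mu>"
  shows "(\<lambda>x. f x + g x) \<in> L2_fun \<mu>"
proof -
  have [measurable]: "f \<in> borel_measurable \<mu>" "g \<in> borel_measurable \<mu>"
    using assms by (auto simp: L2_fun_def)
  have int: "integrable \<mu> (\<lambda>x. 2 * (cmod (f x))\<^sup>2 + 2 * (cmod (g x))\<^sup>2)"
    using assms by (auto simp: L2_fun_def)
  have bound: "(cmod (f x + g x))\<^sup>2 \<le> 2 * (cmod (f x))\<^sup>2 + 2 * (cmod (g x))\<^sup>2" for x
  proof -
    have "(cmod (f x + g x))\<^sup>2 \<le> (cmod (f x) + cmod (g x))\<^sup>2"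
      by (intro power_mono norm_triangle_ineq) auto
    also have "\<dots> \<le> 2 * (cmod (f x))\<^sup>2 + 2 * (cmod (g x))\<^sup>2"
      using zero_le_power2[of "cmod (f x) - cmod (g x)"]
      by (simp add: power2_sum power2_diff)
    finally show ?thesis .
  qed
  have "integrable \<mu> (\<lambda>x. (cmod (f x + g x))\<^sup>2)"
  proof (rule Bochner_Integration.integrable_bound[OF int])
    show "AE x in \<mu>. norm ((cmod (f x + g x))\<^sup>2) \<le> norm (2 * (cmod (f x))\<^sup>2 + 2 * (cmod (g x))\<^sup>2)"
      using bound by (intro AE_I2) simp
  qed simp
  then show ?thesis by (simp add: L2_fun_def)
qed

lemma L2_fun_scale: "f \<in> L2_fun \<mu> \<Longrightarrow> (\<lambda>x. c * f x) \<in> L2_fun \<mu>"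
  by (auto simp: L2_fun_def norm_mult power_mult_distrib)

lemma L2_fun_zero: "(\<lambda>x. 0) \<in> L2_fun \<mu>"
  by (simp add: L2_fun_def)

lemma L2_class_cong:
  assumes "AE x in \<mu>. f x = g x"
  shows "L2_class \<mu> f = L2_class \<mu> g"
proof -
  have "(AE x in \<mu>. h x = f x) \<longleftrightarrow> (AE x in \<mu>. h x = g x)" for h
  proof (rule eventually_subst)
    show "AE x in \<mu>. (h x = f x) = (h x = g x)"
      using assms by eventually_elim simp
  qed
  then show ?thesis by (simp add: L2_class_def)
qed

lemma L2_class_eq_iff:
  assumes "f \<in> L2_fun \<mu>"
  shows "L2_class \<mu> f = L2_class \<mu> g \<longleftrightarrow> (AE x in \<mu>. f x = g x)"
proof
  assume "L2_class \<mu> f = L2_class \<mu> g"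
  then have "f \<in> L2_class \<mu> g" using assms by (auto simp: L2_class_def)
  then show "AE x in \<mu>. f x = g x" by (simp add: L2_class_def)
qed (rule L2_class_cong)

lemma L2_class_refl: "f \<in> L2_fun \<mu> \<Longrightarrow> f \<in> L2_class \<mu> f"
  by (simp add: L2_class_def)

lemma L2_add_class:
  assumes "f \<in> L2_fun \<mu>" "g \<in> L2_fun \<mu>"
  shows "L2_class \<mu> f \<oplus>\<^bsub>L2 \<mu>\<^esub> L2_class \<mu> g = L2_class \<mu> (\<lambda>x. f x + g x)"
proof -
  have eq: "L2_class \<mu> (\<lambda>x. u x + v x) = L2_class \<mu> (\<lambda>x. f x + g x)"
    if "u \<in> L2_class \<mu> f" "v \<in> L2_class \<mu> g" for u v
  proof (rule L2_class_cong)
    have "AE x in \<mu>. u x = f x" "AE x in \<mu>. v x = g x"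
      using that by (simp_all add: L2_class_def)
    then show "AE x in \<mu>. u x + v x = f x + g x"
      by eventually_elim simp
  qed
  have "L2_class \<mu> f \<oplus>\<^bsub>L2 \<mu>\<^esub> L2_class \<mu> g
      = (\<Union>u\<in>L2_class \<mu> f. \<Union>v\<in>L2_class \<mu> g. L2_class \<mu> (\<lambda>x. f x + g x))"
    by (simp add: L2_def eq)
  then show ?thesis
    using assms[THEN L2_class_refl] by blast
qed

lemma L2_smult_class:
  assumes "f \<in> L2_fun \<mu>"
  shows "c \<odot>\<^bsub>L2 \<mu>\<^esub> L2_class \<mu> f = L2_class \<mu> (\<lambda>x. c * f x)"
proof -
  have eq: "L2_class \<mu> (\<lambda>x. c * u x) = L2_class \<mu> (\<lambda>x. c * f x)"
    if "u \<in> L2_class \<mu> f" for u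
  proof (rule L2_class_cong)
    have "AE x in \<mu>. u x = f x"
      using that by (simp add: L2_class_def)
    then show "AE x in \<mu>. c * u x = c * f x"
      by eventually_elim simp
  qed
  have "c \<odot>\<^bsub>L2 \<mu>\<^esub> L2_class \<mu> f = (\<Union>u\<in>L2_class \<mu> f. L2_class \<mu> (\<lambda>x. c * f x))"
    by (simp add: L2_def eq)
  then show ?thesis
    using assms[THEN L2_class_refl] by blast
qed

lemma L2_carrier: "carrier (L2 \<mu>) = L2_class \<mu> ` L2_fun \<mu>"
  and L2_zero: "\<zero>\<^bsub>L2 \<mu>\<^esub> = L2_class \<mu> (\<lambda>x. 0)"
  by (simp_all add: L2_def)

lemma L2_module: "module complex_ring (L2 \<mu>)"
proof (rule moduleI)
  have cases: "\<exists>f\<in>L2_fun \<mu>. A = L2_class \<mu> f" if "A \<in> carrier (L2 \<mu>)" for A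
    using that by (auto simp: L2_carrier)
  have closed: "L2_class \<mu> f \<in> carrier (L2 \<mu>)" if "f \<in> L2_fun \<mu>" for f
    using that by (simp add: L2_carrier)
  note ops = L2_add_class L2_smult_class L2_fun_add L2_fun_scale L2_fun_zero L2_zero closed
  show "cring complex_ring"
    using complex_ring_field by (rule fieldE)
  show "abelian_group (L2 \<mu>)"
  proof (rule abelian_groupI)
    fix A B assume "A \<in> carrier (L2 \<mu>)" "B \<in> carrier (L2 \<mu>)"
    then obtain f g where "f \<in> L2_fun \<mu>" "A = L2_class \<mu> f" "g \<in> L2_fun \<mu>" "B = L2_class \<mu> g"
      using cases by metis
    then show "A \<oplus>\<^bsub>L2 \<mu>\<^esub> B \<in> carrier (L2 \<mu>)" "A \<oplus>\<^bsub>L2 \<mu>\<^esub> B = B \<oplus>\<^bsub>L2 \<mu>\<^esub> A"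
      by (simp_all add: ops add.commute)
  next
    show "\<zero>\<^bsub>L2 \<mu>\<^esub> \<in> carrier (L2 \<mu>)" by (simp add: ops)
  next
    fix A B C assume "A \<in> carrier (L2 \<mu>)" "B \<in> carrier (L2 \<mu>)" "C \<in> carrier (L2 \<mu>)"
    then obtain f g h where "f \<in> L2_fun \<mu>" "A = L2_class \<mu> f" "g \<in> L2_fun \<mu>" "B = L2_class \<mu> g"
      "h \<in> L2_fun \<mu>" "C = L2_class \<mu> h"
      using cases by metis
    then show "A \<oplus>\<^bsub>L2 \<mu>\<^esub> B \<oplus>\<^bsub>L2 \<mu>\<^esub> C = A \<oplus>\<^bsub>L2 \<mu>\<^esub> (B \<oplus>\<^bsub>L2 \<mu>\<^esub> C)"
      by (simp add: ops add.assoc)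
  next
    fix A assume "A \<in> carrier (L2 \<mu>)"
    then obtain f where f: "f \<in> L2_fun \<mu>" "A = L2_class \<mu> f"
      using cases by metis
    then show "\<zero>\<^bsub>L2 \<mu>\<^esub> \<oplus>\<^bsub>L2 \<mu>\<^esub> A = A" by (simp add: ops)
    have "L2_class \<mu> (\<lambda>x. (-1) * f x) \<oplus>\<^bsub>L2 \<mu>\<^esub> A = \<zero>\<^bsub>L2 \<mu>\<^esub>"
      unfolding f(2) L2_add_class[OF L2_fun_scale[OF f(1)] f(1)] L2_zero by simp
    moreover have "L2_class \<mu> (\<lambda>x. (-1) * f x) \<in> carrier (L2 \<mu>)"
      using f by (intro closed L2_fun_scale)
    ultimately show "\<exists>B\<in>carrier (L2 \<mu>). B \<oplus>\<^bsub>L2 \<mu>\<^esub> A = \<zero>\<^bsub>L2 \<mu>\<^esub>" ..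
  qed
  fix a b :: complex and A assume "A \<in> carrier (L2 \<mu>)"
  then obtain f where f: "f \<in> L2_fun \<mu>" "A = L2_class \<mu> f"
    using cases by metis
  then show "a \<odot>\<^bsub>L2 \<mu>\<^esub> A \<in> carrier (L2 \<mu>)"
    and "(a \<oplus>\<^bsub>complex_ring\<^esub> b) \<odot>\<^bsub>L2 \<mu>\<^esub> A = a \<odot>\<^bsub>L2 \<mu>\<^esub> A \<oplus>\<^bsub>L2 \<mu>\<^esub> b \<odot>\<^bsub>L2 \<mu>\<^esub> A"
    and "(a \<otimes>\<^bsub>complex_ring\<^esub> b) \<odot>\<^bsub>L2 \<mu>\<^esub> A = a \<odot>\<^bsub>L2 \<mu>\<^esub> (b \<odot>\<^bsub>L2 \<mu>\<^esub> A)"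
    and "\<one>\<^bsub>complex_ring\<^esub> \<odot>\<^bsub>L2 \<mu>\<^esub> A = A"
    by (simp_all add: ops complex_ring_def distrib_right mult.assoc)
  fix B assume "B \<in> carrier (L2 \<mu>)"
  then obtain g where "g \<in> L2_fun \<mu>" "B = L2_class \<mu> g"
    using cases by metis
  with f show "a \<odot>\<^bsub>L2 \<mu>\<^esub> (A \<oplus>\<^bsub>L2 \<mu>\<^esub> B) = a \<odot>\<^bsub>L2 \<mu>\<^esub> A \<oplus>\<^bsub>L2 \<mu>\<^esub> a \<odot>\<^bsub>L2 \<mu>\<^esub> B"
    by (simp add: ops distrib_left)
qed

text \<open>Independence of the indexed family, so that repeated vectors are excluded.\<close>

definition lin_indep_family ::
  "('k, 'm) ring_scheme \<Rightarrow> ('k, 'v, 'n) module_scheme \<Rightarrow> 'i set \<Rightarrow> ('i \<Rightarrow> 'v) \<Rightarrow> bool" where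
  "lin_indep_family K V I v \<longleftrightarrow>
     v \<in> I \<rightarrow> carrier V \<and>
     (\<forall>S c. finite S \<and> S \<subseteq> I \<and> c \<in> S \<rightarrow> carrier K \<and>
        (\<Oplus>\<^bsub>V\<^esub>i\<in>S. c i \<odot>\<^bsub>V\<^esub> v i) = \<zero>\<^bsub>V\<^esub> \<longrightarrow> (\<forall>i\<in>S. c i = \<zero>\<^bsub>K\<^esub>))"

end

theory Submission
  imports Defs
begin

text \<open>A combination of the functions \<open>exp (\<i> \<langle>x, x'\<rangle>)\<close> is continuous, so if it vanishes almost
  everywhere then it vanishes on the support of the measure. Under the linear support hypothesis the
  support is a closed linear subspace, and on its additive group the functions are pairwise distinct
  characters, whence Dedekind's lemma applies.\<close>

text \<open>Dedekind's argument: translate a relation by \<open>v\<close> and subtract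
  \<open>\<psi> j v\<close> times the original relation. The term of \<open>j\<close> cancels, and a
  relation over fewer characters remains. Only sums of points of \<open>V\<close> and the absence of
  zero divisors in the values enter, so neither inverses in \<open>V\<close> nor division are
  involved.\<close>

lemma characters_linearly_independent:
  fixes \<psi> :: "'i \<Rightarrow> 'a::plus \<Rightarrow> 'k::idom"
  assumes "finite S"
    and add_closed: "\<And>x y. x \<in> V \<Longrightarrow> y \<in> V \<Longrightarrow> x + y \<in> V"
    and "\<And>i x y. i \<in> S \<Longrightarrow> x \<in> V \<Longrightarrow> y \<in> V \<Longrightarrow> \<psi> i (x + y) = \<psi> i x * \<psi> i y"
    and "\<And>i. i \<in> S \<Longrightarrow> \<exists>x\<in>V. \<psi> i x \<noteq> 0"
    and "\<And>i j. i \<in> S \<Longrightarrow> j \<in> S \<Longrightarrow> i \<noteq> j \<Longrightarrow> \<exists>x\<in>V. \<psi> i x \<noteq> \<psi> j x"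
    and "\<And>x. x \<in> V \<Longrightarrow> (\<Sum>i\<in>S. c i * \<psi> i x) = 0"
    and "i \<in> S"
  shows "c i = 0"
  using assms(1,3-)
\<comment> \<open>The coefficients must vary, because the shortened relation has new ones.\<close>
proof (induction S arbitrary: c i rule: finite_induct)
  case empty
  then show ?case by simp
next
  case (insert j S)
  have zero: "c i = 0" if i: "i \<in> S" for i
  proof -
    have "i \<noteq> j" using i insert.hyps by auto
    then obtain v where v: "v \<in> V" "\<psi> i v \<noteq> \<psi> j v"
      using insert.prems(3)[of i j] i by auto
    \<comment> \<open>This is the coefficient of \<open>i\<close> in the shortened relation. Since
      \<open>v\<close> separates \<open>i\<close> from \<open>j\<close>, the second factor is
      nonzero and can be cancelled.\<close>
    have "c i * (\<psi> i v - \<psi> j v) = 0"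
    proof (rule insert.IH[where c = "\<lambda>k. c k * (\<psi> k v - \<psi> j v)"])
      fix x assume x: "x \<in> V"
      \<comment> \<open>The term of \<open>j\<close> may be added back, as its factor
        \<open>\<psi> j v - \<psi> j v\<close> is 0; then both sums run over the full index set of
        the given relation.\<close>
      have "(\<Sum>k\<in>S. c k * (\<psi> k v - \<psi> j v) * \<psi> k x)
          = (\<Sum>k\<in>insert j S. c k * (\<psi> k v - \<psi> j v) * \<psi> k x)"
        using insert.hyps by simp
      also have "\<dots> = (\<Sum>k\<in>insert j S. c k * \<psi> k (v + x) - \<psi> j v * (c k * \<psi> k x))"
        using insert.prems(1)[OF _ v(1) x] by (intro sum.cong) (auto simp: algebra_simps)
      also have "\<dots> = (\<Sum>k\<in>insert j S. c k * \<psi> k (v + x))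
          - \<psi> j v * (\<Sum>k\<in>insert j S. c k * \<psi> k x)"
        by (simp add: sum_subtractf sum_distrib_left del: sum.insert)
      also have "\<dots> = 0"
        using insert.prems(4)[OF x] insert.prems(4)[OF add_closed[OF v(1) x]] by simp
      finally show "(\<Sum>k\<in>S. c k * (\<psi> k v - \<psi> j v) * \<psi> k x) = 0" .
    qed (use insert.prems i in auto)
    then show ?thesis using v by simp
  qed
  obtain x where x: "x \<in> V" "\<psi> j x \<noteq> 0"
    using insert.prems(2) by blast
  have "c j * \<psi> j x = 0"
    using insert.prems(4)[OF x(1)] insert.hyps zero by simp
  then have "c j = 0" using x by simp
  then show ?case using zero insert.prems(5) by auto
qed

text \<open>A single value of the exponential fixes the phase only modulo 2 pi, hence the real
  parameter \<open>t\<close>. If \<open>a\<close> and \<open>b\<close> differed, then at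
  \<open>t = pi / (a - b)\<close> the two phases would differ by exactly pi, and the exponentials
  would be opposite and nonzero.\<close>

lemma exp_imaginary_eq_imp_eq:
  fixes a b :: real
  assumes eq: "\<And>t::real. exp (\<i> * of_real (t * a)) = exp (\<i> * of_real (t * b))"
  shows "a = b"
proof (rule ccontr)
  assume "a \<noteq> b"
  then have "pi / (a - b) * a = pi / (a - b) * b + pi"
    by (simp add: field_simps)
  then have "\<i> * of_real (pi / (a - b) * a) = \<i> * of_real (pi / (a - b) * b) + \<i> * of_real pi"
    by (simp only: of_real_add distrib_left)
  then have "exp (\<i> * of_real (pi / (a - b) * a)) = - exp (\<i> * of_real (pi / (a - b) * b))"
    by (simp add: exp_add del: of_real_mult of_real_divide)
  then have "exp (\<i> * of_real (pi / (a - b) * b)) = - exp (\<i> * of_real (pi / (a - b) * b))"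
    by (simp only: eq)
  then show False by (simp del: of_real_mult of_real_divide)
qed

text \<open>The set where \<open>h\<close> is nonzero is open by continuity and null by assumption,
  so it is one of the sets removed in forming the support.\<close>

lemma continuous_AE_zero_imp_zero_on_support:
  fixes h :: "'a::topological_space \<Rightarrow> 'b::real_normed_vector"
  assumes "sets \<mu> = sets borel" "continuous_on UNIV h" "AE x in \<mu>. h x = 0"
    and "x \<in> measure_support \<mu>"
  shows "h x = 0"
proof -
  let ?U = "{y. h y \<noteq> 0}"
  have "?U = h -` (- {0})" by auto
  then have "open ?U"
    using assms(2) by (metis open_Compl closed_singleton open_vimage)
  moreover have "emeasure \<mu> ?U = 0"
  proof -
    have "?U \<in> sets \<mu>" using \<open>open ?U\<close> assms(1) by simp
    moreover have "space \<mu> = UNIV" using sets_eq_imp_space_eq[OF assms(1)] by simp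
    ultimately show ?thesis using assms(3) AE_iff_measurable[of ?U \<mu> "\<lambda>y. h y = 0"] by simp
  qed
  ultimately show ?thesis using assms(4) unfolding measure_support_def by auto
qed

lemma subspace_closure:
  fixes S :: "'a::real_normed_vector set"
  assumes "subspace S"
  shows "subspace (closure S)"
proof (rule subspaceI)
  show "0 \<in> closure S"
    using subspace_0[OF assms] closure_subset by blast
next
  fix x y assume "x \<in> closure S" "y \<in> closure S"
  then obtain f g where fg: "\<And>n. f n \<in> S" "f \<longlonglongrightarrow> x" "\<And>n. g n \<in> S" "g \<longlonglongrightarrow> y"
    unfolding closure_sequential by blast
  then have "\<And>n. f n + g n \<in> S" "(\<lambda>n. f n + g n) \<longlonglongrightarrow> x + y"
    using subspace_add[OF assms] by (auto intro: tendsto_add)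
  then show "x + y \<in> closure S"
    unfolding closure_sequential by (intro exI[of _ "\<lambda>n. f n + g n"]) simp
next
  fix c :: real and x assume "x \<in> closure S"
  then obtain f where "\<And>n. f n \<in> S" "f \<longlonglongrightarrow> x"
    unfolding closure_sequential by blast
  then have "\<And>n. c *\<^sub>R f n \<in> S" "(\<lambda>n. c *\<^sub>R f n) \<longlonglongrightarrow> c *\<^sub>R x"
    using subspace_scale[OF assms] by (auto intro: tendsto_scaleR)
  then show "c *\<^sub>R x \<in> closure S"
    unfolding closure_sequential by (intro exI[of _ "\<lambda>n. c *\<^sub>R f n"]) simp
qed

lemma L2_fun_sum:
  assumes "\<And>i. i \<in> S \<Longrightarrow> f i \<in> L2_fun \<mu>"
  shows "(\<lambda>x. \<Sum>i\<in>S. f i x) \<in> L2_fun \<mu>"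
  \<comment> \<open>Over an infinite \<open>S\<close> the sum is 0 by convention, which
    \<open>L2_fun_zero\<close> covers.\<close>
  using assms by (induction S rule: infinite_finite_induct) (auto intro: L2_fun_add L2_fun_zero)

lemma L2_finsum_class:
  assumes "finite S" "\<And>i. i \<in> S \<Longrightarrow> f i \<in> L2_fun \<mu>"
  shows "(\<Oplus>\<^bsub>L2 \<mu>\<^esub>i\<in>S. L2_class \<mu> (f i)) = L2_class \<mu> (\<lambda>x. \<Sum>i\<in>S. f i x)"
proof -
  interpret module complex_ring "L2 \<mu>" by (rule L2_module)
  show ?thesis
    using assms
  proof (induction S rule: finite_induct)
    case empty
    then show ?case by (simp add: L2_zero)
  next
    case (insert j S)
    have "(\<Oplus>\<^bsub>L2 \<mu>\<^esub>i\<in>insert j S. L2_class \<mu> (f i))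
        = L2_class \<mu> (f j) \<oplus>\<^bsub>L2 \<mu>\<^esub> (\<Oplus>\<^bsub>L2 \<mu>\<^esub>i\<in>S. L2_class \<mu> (f i))"
      using insert.hyps insert.prems by (intro M.finsum_insert) (auto simp: L2_carrier)
    then show ?case
      using insert by (simp add: L2_add_class L2_fun_sum)
  qed
qed

lemma bounded_measurable_in_L2_fun:
  assumes "finite_measure \<mu>" "f \<in> borel_measurable \<mu>" "\<And>x. cmod (f x) \<le> B"
  shows "f \<in> L2_fun \<mu>"
proof -
  interpret finite_measure \<mu> by fact
  have "(cmod (f x))\<^sup>2 \<le> B\<^sup>2" for x
    using assms(3) by (intro power_mono) auto
  then have "integrable \<mu> (\<lambda>x. (cmod (f x))\<^sup>2)"
    using assms(2) by (intro integrable_const_bound[where B = "B\<^sup>2"]) auto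
  then show ?thesis using assms(2) by (simp add: L2_fun_def)
qed

theorem propositionA1:
  fixes \<mu> :: "'a::banach measure" and F :: "('a \<Rightarrow>\<^sub>L real) set"
  assumes "finite_radon_measure \<mu>"
    and "linear_support \<mu>"
    and "\<forall>x'\<in>F. \<forall>y'\<in>F. x' \<noteq> y' \<longrightarrow>
           (\<exists>x\<in>closed_linear_span (measure_support \<mu>). blinfun_apply x' x \<noteq> blinfun_apply y' x)"
  shows "lin_indep_family complex_ring (L2 \<mu>) F
           (\<lambda>x'. L2_class \<mu> (\<lambda>x. exp (\<i> * complex_of_real (blinfun_apply x' x))))"
proof -
  define \<psi> where "\<psi> x' x = exp (\<i> * complex_of_real (blinfun_apply x' x))"
    for x' :: "'a \<Rightarrow>\<^sub>L real" and x
  define V where "V = closed_linear_span (measure_support \<mu>)"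
  have sets: "sets \<mu> = sets borel" and fin: "finite_measure \<mu>"
    using assms(1) by (auto simp: finite_radon_measure_def)
  \<comment> \<open>Here linear support enters: the points that separate \<open>F\<close> are points
    of the support, where relations valid almost everywhere hold exactly.\<close>
  have supp: "measure_support \<mu> = V"
    using assms(2) by (simp add: linear_support_def V_def)
  have V: "subspace V"
    unfolding V_def closed_linear_span_def by (intro subspace_closure subspace_span)
  have cont: "continuous_on UNIV (\<psi> x')" for x'
    unfolding \<psi>_def by (intro continuous_intros)
  have L2: "\<psi> x' \<in> L2_fun \<mu>" for x'
  proof (rule bounded_measurable_in_L2_fun[OF fin])
    show "\<psi> x' \<in> borel_measurable \<mu>"
      using borel_measurable_continuous_onI[OF cont] measurable_cong_sets[OF sets refl] by blast
    show "cmod (\<psi> x' x) \<le> 1" for x by (simp add: \<psi>_def)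
  qed
  have distinct: "\<exists>x\<in>V. \<psi> x' x \<noteq> \<psi> y' x" if xy: "x' \<in> F" "y' \<in> F" "x' \<noteq> y'" for x' y'
  proof (rule ccontr)
    assume "\<not> ?thesis"
    then have eq: "\<psi> x' x = \<psi> y' x" if "x \<in> V" for x using that by blast
    obtain x where x: "x \<in> V" "blinfun_apply x' x \<noteq> blinfun_apply y' x"
      using assms(3) xy V_def by blast
    \<comment> \<open>As \<open>V\<close> is closed under real scaling, the two characters agree
      along the whole line through \<open>x\<close>, which removes the ambiguity modulo 2
      pi.\<close>
    have "blinfun_apply x' x = blinfun_apply y' x"
      using eq[OF subspace_scale[OF V x(1)]]
      by (intro exp_imaginary_eq_imp_eq) (simp add: \<psi>_def blinfun.scaleR_right)
    with x(2) show False ..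
  qed
  have "c i = 0"
    if S: "finite S" "S \<subseteq> F" "i \<in> S"
      and sum: "(\<Oplus>\<^bsub>L2 \<mu>\<^esub>i\<in>S. c i \<odot>\<^bsub>L2 \<mu>\<^esub> L2_class \<mu> (\<psi> i)) = \<zero>\<^bsub>L2 \<mu>\<^esub>" for S c i
  proof (rule characters_linearly_independent[where V = V and \<psi> = \<psi> and S = S])
    fix x assume "x \<in> V"
    \<comment> \<open>The relation between classes passes to the representatives
      \<open>\<psi> i\<close>: first as an equality almost everywhere, then, by continuity, at every
      point of \<open>V\<close>.\<close>
    have "L2_class \<mu> (\<lambda>x. \<Sum>i\<in>S. c i * \<psi> i x) = L2_class \<mu> (\<lambda>x. 0)"
      using sum S(1) by (simp add: L2_smult_class L2 L2_finsum_class L2_fun_scale L2_zero)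
    then have "AE x in \<mu>. (\<Sum>i\<in>S. c i * \<psi> i x) = 0"
      by (subst (asm) L2_class_eq_iff) (intro L2_fun_sum L2_fun_scale L2)
    then show "(\<Sum>i\<in>S. c i * \<psi> i x) = 0"
      using \<open>x \<in> V\<close> supp
      by (intro continuous_AE_zero_imp_zero_on_support[OF sets, of "\<lambda>x. \<Sum>i\<in>S. c i * \<psi> i x"])
        (auto intro!: continuous_intros cont)
  next
    show "\<exists>x\<in>V. \<psi> i x \<noteq> 0" for i
      \<comment> \<open>The exponential never vanishes, so any point of \<open>V\<close> will do;
        the origin is at hand.\<close>
      using subspace_0[OF V] by (auto simp: \<psi>_def)
    show "\<psi> i (x + y) = \<psi> i x * \<psi> i y" for i x y
      by (simp add: \<psi>_def blinfun.add_right distrib_left exp_add)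
    show "\<exists>x\<in>V. \<psi> i x \<noteq> \<psi> j x" if "i \<in> S" "j \<in> S" "i \<noteq> j" for i j
      using distinct that S(2) by blast
  qed (use S V in \<open>auto intro: subspace_add\<close>)
  then show ?thesis
    using L2 unfolding lin_indep_family_def \<psi>_def[symmetric]
    by (auto simp: L2_carrier complex_ring_def)
qed

end
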